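(* Let $Y$ be a vertex algebra structure on the chiral boson. Given finite sets $S_1,S_2\subset\mathbb P\setminus P$, states $\mathtt v_1\in{}_{S_1}\mathbf W$, $\mathtt v_2\in{}_{S_2}\mathbf W$ and translations $v_1,v_2$ with $(S_1+v_1)\cap(S_2+v_2)=\emptyset$, one has $$Y(\mathtt v_1,v_1)\circ Y(\mathtt v_2,v_2)=Y\bigl(Y(\mathtt v_1,v_1-v_2)\mathtt v_2,\ v_2\bigr)$$ on $\mathbf W^{(S_1+v_1)\cup(S_2+v_2)}$.
   Context: Fix a point $P$ of a complex projective line $\mathbb P$. Translations are the automorphisms in the additive group ($\cong\mathbb C$) of translations of the affine line $\mathbb P\setminus P$; $z+v$ is the action of $v$ on $z$; in a coordinate $u$ with pole at $P$, $u(z+v)=u(z)+u(v)$. $\mathbf K$ is the space of meromorphic 1-forms on $\mathbb P$ with all residues zero, regular at $P$; $\mathbf W=S^*\mathbf K$, vacuum $\mathbf 1$. For a finite set $S\subset\mathbb P\setminus P$: ${}_S\mathbf W=S^*({}_S\mathbf K)$ with ${}_S\mathbf K\subset\mathbf K$ the forms with all poles in $S$; $\mathbf W^S=S^*(\mathbf K^S)$ with $\mathbf K^S\subset\mathbf K$ the forms regular at every point of $S$. $\mathsf T_v:\mathbf W\to\mathbf W$ is induced by $a(u)du\mapsto a(u-u(v))du$ and maps ${}_S\mathbf W$ to ${}_{S+v}\mathbf W$. For $O\ne P$ and $\lambda\in\mathbb C^*=\mathrm{Aut}_{O,P}(\mathbb P)$ acting by $u(\lambda(z))=\lambda u(z)$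 (with $u(O)=0$, $u(P)=\infty$), $\mathsf R_\lambda$ is the operator on $\mathbf W$ induced by pull-back by $\lambda^{-1}$. A vertex algebra structure on the chiral boson is an assignment, linear in the state, to each finite set $S$, state $\mathtt v\in{}_S\mathbf W$ and translation $v$ of an operator $Y(\mathtt v,v):\mathbf W^{S+v}\to\mathbf W$ (compatible with enlarging $S$), such that: 1. if $\mathtt v'\in{}_{S'}\mathbf W\cap\mathbf W^{S+v}$ then $Y(\mathtt v,v)\mathtt v'\in{}_{S'\cup(S+v)}\mathbf W$; 2. $Y(\mathbf 1,v)=\mathrm{Id}$; 3. $Y(\mathtt v,0)\mathbf 1=\mathtt v$; 4. for $\mathtt v\in{}_S\mathbf W$, $\mathtt v'\in{}_{S'}\mathbf W$, the operators $Y(\mathtt v,v)$ and $Y(\mathtt v',v')$ commute if $S+v$ is disjoint from $S'+v'$ (where both compositions are defined); 5. $Y(\mathtt v,v+v')=\mathsf T_{v'}\circ Y(\mathtt v,v)\circ\mathsf T_{-v'}$ for translations $v,v'$; 6. $Y$ is $\mathrm{Aut}_P(\mathbb P)$-covariant: $Y(\mathsf T_{v'}\mathtt v,v)=\mathsf T_{v'}Y(\mathtt v,v)\mathsf T_{-v'}$ and $Y(\mathsf R_\lambda\mathtt v,\lambda v)=\mathsf R_\lambda Y(\mathtt v,v)\mathsf R_{\lambda^{-1}}$ for rotations $\lambda$ about any point $O$; 7. for a fixed point $O$, the vectors $Y(\mathtt v_n,v_n)\cdots Y(\mathtt v_1,v_1)\mathbf 1$, over all sequences of distinct translations $v_i$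 and states $\mathtt v_i\in{}_{\{O\}}\mathbf W$, span $\mathbf W$. *)

theory Defs
  imports "HOL-Complex_Analysis.Complex_Analysis" "HOL-Library.Multiset" "HOL-Library.Poly_Mapping"
begin

class complex_vector = ab_group_add +
  fixes scaleC :: "complex \<Rightarrow> 'a \<Rightarrow> 'a" (infixr \<open>*\<^sub>C\<close> 75)
  assumes scaleC_add_right: "a *\<^sub>C (x + y) = a *\<^sub>C x + a *\<^sub>C y"
    and scaleC_add_left: "(a + b) *\<^sub>C x = a *\<^sub>C x + b *\<^sub>C x"
    and scaleC_scaleC: "a *\<^sub>C b *\<^sub>C x = (a * b) *\<^sub>C x"
    and scaleC_one: "1 *\<^sub>C x = x"

global_interpretation complex_vector: vector_space "scaleC :: complex \<Rightarrow> 'a \<Rightarrow> 'a::complex_vector"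
  by unfold_locales (simp_all add: scaleC_add_right scaleC_add_left scaleC_scaleC scaleC_one)

abbreviation clinear :: "('a::complex_vector \<Rightarrow> 'b::complex_vector) \<Rightarrow> bool"
  where "clinear \<equiv> Vector_Spaces.linear scaleC scaleC"

definition clinear_on :: "'a::complex_vector set \<Rightarrow> ('a \<Rightarrow> 'b::complex_vector) \<Rightarrow> bool" where
  "clinear_on A f \<longleftrightarrow>
     (\<forall>x\<in>A. \<forall>y\<in>A. f (x + y) = f x + f y) \<and> (\<forall>c. \<forall>x\<in>A. f (c *\<^sub>C x) = c *\<^sub>C f x)"

text \<open>
  The symmetric algebra of \<open>V\<close> is the polynomial ring on the elements of \<open>V\<close> (the monoid
  algebra of finite multisets in \<open>V\<close>) modulo the ideal expressing that \<open>V\<close> embeds linearly.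
\<close>

type_synonym 'a free_calg = "'a multiset \<Rightarrow>\<^sub>0 complex"

definition free_gen :: "'a \<Rightarrow> 'a free_calg" where
  "free_gen a = Poly_Mapping.single {#a#} 1"

definition free_const :: "complex \<Rightarrow> 'a free_calg" where
  "free_const c = Poly_Mapping.single {#} c"

definition sym_relators :: "'a::complex_vector free_calg set" where
  "sym_relators = {free_gen (a + b) - free_gen a - free_gen b | a b. True}
                \<union> {free_gen (c *\<^sub>C a) - free_const c * free_gen a | c a. True}"

global_interpretation self_module: module "(*) :: 'a \<Rightarrow> 'a \<Rightarrow> 'a::comm_ring_1"
  by unfold_locales (simp_all add: algebra_simps)

text \<open>A span inside a commutative ring regarded as a module over itself is the ideal generated.\<close>

definition sym_ideal :: "'a::complex_vector free_calg set" where
  "sym_ideal = self_module.span sym_relators"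

definition sym_rel :: "'a::complex_vector free_calg \<Rightarrow> 'a free_calg \<Rightarrow> bool" where
  "sym_rel x y \<longleftrightarrow> x - y \<in> sym_ideal"

lemma sym_ideal_0: "0 \<in> sym_ideal"
  and sym_ideal_add: "x \<in> sym_ideal \<Longrightarrow> y \<in> sym_ideal \<Longrightarrow> x + y \<in> sym_ideal"
  and sym_ideal_diff: "x \<in> sym_ideal \<Longrightarrow> y \<in> sym_ideal \<Longrightarrow> x - y \<in> sym_ideal"
  and sym_ideal_mult: "x \<in> sym_ideal \<Longrightarrow> z * x \<in> sym_ideal"
  unfolding sym_ideal_def
  by (auto intro: self_module.span_zero self_module.span_add self_module.span_diff
      self_module.span_scale)

lemma equivp_sym_rel: "equivp (sym_rel :: 'a::complex_vector free_calg \<Rightarrow> _)" (is "equivp ?R")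
proof (rule equivpI)
  show "reflp ?R"
    by (simp add: reflp_def sym_rel_def sym_ideal_0)
  show "symp ?R"
  proof (rule sympI)
    show "sym_rel y x" if "sym_rel x y" for x y :: "'a free_calg"
      using sym_ideal_diff[OF sym_ideal_0, of "x - y"] that by (simp add: sym_rel_def)
  qed
  show "transp ?R"
  proof (rule transpI)
    show "sym_rel x z" if "sym_rel x y" "sym_rel y z" for x y z :: "'a free_calg"
      using sym_ideal_add[of "x - y" "y - z"] that by (simp add: sym_rel_def)
  qed
qed

lemma sym_rel_add: "sym_rel x x' \<Longrightarrow> sym_rel y y' \<Longrightarrow> sym_rel (x + y) (x' + y')"
  using sym_ideal_add[of "x - x'" "y - y'"] by (simp add: sym_rel_def algebra_simps)

lemma sym_rel_uminus: "sym_rel x x' \<Longrightarrow> sym_rel (- x) (- x')"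
  using sym_ideal_diff[OF sym_ideal_0, of "x - x'"] by (simp add: sym_rel_def)

lemma sym_rel_diff: "sym_rel x x' \<Longrightarrow> sym_rel y y' \<Longrightarrow> sym_rel (x - y) (x' - y')"
  using sym_ideal_diff[of "x - x'" "y - y'"] by (simp add: sym_rel_def algebra_simps)

lemma sym_rel_mult:
  assumes "sym_rel x x'" "sym_rel y y'"
  shows "sym_rel (x * y) (x' * y')"
proof -
  have "x * y - x' * y' = y * (x - x') + x' * (y - y')"
    by (simp add: algebra_simps)
  then show ?thesis
    using assms by (simp add: sym_rel_def sym_ideal_add sym_ideal_mult)
qed

text \<open>Evaluation at the origin; it shows that the quotient is not the zero ring.\<close>

lemma lookup_mult_empty:
  fixes x y :: "'a free_calg"
  shows "Poly_Mapping.lookup (x * y) {#} = Poly_Mapping.lookup x {#} * Poly_Mapping.lookup y {#}"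
proof -
  have 1: "(\<Sum>q. Poly_Mapping.lookup y q when ({#} = l + q)) = (Poly_Mapping.lookup y {#} when (l = {#}))"
    for l :: "'a multiset"
  proof (cases "l = {#}")
    case True
    then show ?thesis by simp
  next
    case False
    then show ?thesis by simp
  qed
  show ?thesis
    unfolding lookup_mult 1 by (simp add: mult_when)
qed

lemma lookup_sym_ideal:
  assumes "x \<in> sym_ideal"
  shows "Poly_Mapping.lookup x {#} = 0"
  using assms unfolding sym_ideal_def
proof (induction rule: self_module.span_induct_alt)
  case base
  then show ?case by simp
next
  case (step c r y)
  then have "Poly_Mapping.lookup r {#} = 0"
    by (auto simp: sym_relators_def free_gen_def free_const_def lookup_minus
        lookup_single lookup_mult_empty)
  with step show ?case
    by (simp add: lookup_add lookup_mult_empty)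
qed

quotient_type (overloaded) 'a sym = "'a::complex_vector free_calg" / sym_rel
  by (rule equivp_sym_rel)

instantiation sym :: (complex_vector) comm_ring_1
begin

lift_definition zero_sym :: "'a sym" is 0 .
lift_definition one_sym :: "'a sym" is 1 .
lift_definition plus_sym :: "'a sym \<Rightarrow> 'a sym \<Rightarrow> 'a sym" is "(+)"
  by (rule sym_rel_add)
lift_definition uminus_sym :: "'a sym \<Rightarrow> 'a sym" is "uminus"
  by (rule sym_rel_uminus)
lift_definition minus_sym :: "'a sym \<Rightarrow> 'a sym \<Rightarrow> 'a sym" is "(-)"
  by (rule sym_rel_diff)
lift_definition times_sym :: "'a sym \<Rightarrow> 'a sym \<Rightarrow> 'a sym" is "(*)"
  by (rule sym_rel_mult)

instance
proof
  fix a b c :: "'a sym"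
  have r: "sym_rel x x" for x :: "'a free_calg"
    by (simp add: sym_rel_def sym_ideal_0)
  show "a + b + c = a + (b + c)" by (transfer, simp only: add.assoc r)
  show "a + b = b + a" by (transfer, simp only: add.commute r)
  show "0 + a = a" by (transfer, simp only: add_0_left r)
  show "- a + a = 0" by (transfer, simp only: left_minus r)
  show "a - b = a + - b" by (transfer, simp only: diff_conv_add_uminus r)
  show "a * b * c = a * (b * c)" by (transfer, simp only: mult.assoc r)
  show "a * b = b * a" by (transfer, simp only: mult.commute r)
  show "1 * a = a" by (transfer, simp only: mult_1_left r)
  show "(a + b) * c = a * c + b * c" by (transfer, simp only: distrib_right r)
  show "0 \<noteq> (1 :: 'a sym)"
  proof (transfer, rule notI)
    assume "sym_rel (0 :: 'a free_calg) 1"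
    then have "Poly_Mapping.lookup (0 - 1 :: 'a free_calg) {#} = 0"
      unfolding sym_rel_def by (rule lookup_sym_ideal)
    then show False
      by (simp add: lookup_minus lookup_one)
  qed
qed

end

instantiation sym :: (complex_vector) complex_vector
begin

lift_definition scaleC_sym :: "complex \<Rightarrow> 'a sym \<Rightarrow> 'a sym" is "\<lambda>c x. free_const c * x"
  by (simp add: sym_rel_def sym_ideal_mult flip: right_diff_distrib)

instance
proof
  fix a b :: complex and x y :: "'a sym"
  have r: "sym_rel x x" for x :: "'a free_calg"
    by (simp add: sym_rel_def sym_ideal_0)
  have c_add: "free_const (a + b) = (free_const a + free_const b :: 'a free_calg)" for a b
    by (simp add: free_const_def single_add)
  have c_mult: "free_const (a * b) = (free_const a * free_const b :: 'a free_calg)" for a b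
    by (simp add: free_const_def mult_single)
  have c_1: "free_const 1 = (1 :: 'a free_calg)"
    by (simp add: free_const_def poly_mapping_eq_iff fun_eq_iff lookup_one lookup_single)
  show "a *\<^sub>C (x + y) = a *\<^sub>C x + a *\<^sub>C y" by (transfer, simp only: distrib_left r)
  show "(a + b) *\<^sub>C x = a *\<^sub>C x + b *\<^sub>C x" by (transfer, simp only: c_add distrib_right r)
  show "a *\<^sub>C b *\<^sub>C x = (a * b) *\<^sub>C x" by (transfer, simp only: c_mult mult.assoc r)
  show "1 *\<^sub>C x = x" by (transfer, simp only: c_1 mult_1_left r)
qed

end

lift_definition sym_incl :: "'a::complex_vector \<Rightarrow> 'a sym" is free_gen .

text \<open>
  For a subspace \<open>A\<close> the natural map from the symmetric algebra of \<open>A\<close> to that of the whole space is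
  injective; its image is the subalgebra generated by \<open>A\<close>.
\<close>

inductive_set Sym :: "'a::complex_vector set \<Rightarrow> 'a sym set" for A where
  one: "1 \<in> Sym A"
| incl: "a \<in> A \<Longrightarrow> sym_incl a \<in> Sym A"
| add: "x \<in> Sym A \<Longrightarrow> y \<in> Sym A \<Longrightarrow> x + y \<in> Sym A"
| mult: "x \<in> Sym A \<Longrightarrow> y \<in> Sym A \<Longrightarrow> x * y \<in> Sym A"
| scale: "x \<in> Sym A \<Longrightarrow> c *\<^sub>C x \<in> Sym A"

definition free_map :: "('a \<Rightarrow> 'b) \<Rightarrow> 'a free_calg \<Rightarrow> 'b free_calg" where
  "free_map f x = (\<Sum>m\<in>Poly_Mapping.keys x. Poly_Mapping.single (image_mset f m) (Poly_Mapping.lookup x m))"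

lemma free_map_add: "free_map f (x + y) = free_map f x + free_map f y"
  unfolding free_map_def by (rule setsum_keys_plus_distrib) (simp_all add: single_add)

lemma free_map_single: "free_map f (Poly_Mapping.single m c) = Poly_Mapping.single (image_mset f m) c"
  by (simp add: free_map_def)

lemma free_map_0: "free_map f 0 = 0"
  by (simp add: free_map_def)

lemma free_map_uminus: "free_map f (- x) = - free_map f x"
  using free_map_add[of f x "- x"] by (simp add: free_map_0 eq_neg_iff_add_eq_0 add.commute)

lemma free_map_diff: "free_map f (x - y) = free_map f x - free_map f y"
  using free_map_add[of f x "- y"] by (simp add: free_map_uminus)

lemma free_calg_eq_sum:
  "x = (\<Sum>m\<in>Poly_Mapping.keys x. Poly_Mapping.single m (Poly_Mapping.lookup x m))"
  for x :: "'a free_calg"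
proof (rule poly_mapping_eqI)
  fix k
  show "Poly_Mapping.lookup x k = Poly_Mapping.lookup
      (\<Sum>m\<in>Poly_Mapping.keys x. Poly_Mapping.single m (Poly_Mapping.lookup x m)) k"
    by (cases "k \<in> Poly_Mapping.keys x")
       (auto simp: lookup_sum lookup_single when_def in_keys_iff)
qed

lemma free_map_sum: "free_map f (sum g A) = (\<Sum>i\<in>A. free_map f (g i))"
  by (induction A rule: infinite_finite_induct) (simp_all add: free_map_0 free_map_add)

lemma free_map_mult: "free_map f (x * y) = free_map f x * free_map f y"
proof -
  let ?s = "\<lambda>z m. Poly_Mapping.single m (Poly_Mapping.lookup z m)"
  have "free_map f (x * y) = free_map f (sum (?s x) (Poly_Mapping.keys x) * sum (?s y) (Poly_Mapping.keys y))"
    by (simp only: free_calg_eq_sum[symmetric])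
  also have "\<dots> = free_map f (sum (?s x) (Poly_Mapping.keys x)) * free_map f (sum (?s y) (Poly_Mapping.keys y))"
    by (simp add: sum_product free_map_sum free_map_single mult_single)
  also have "\<dots> = free_map f x * free_map f y"
    by (simp only: free_calg_eq_sum[symmetric])
  finally show ?thesis .
qed

lemma free_map_ideal:
  assumes "clinear f" "x \<in> sym_ideal"
  shows "free_map f x \<in> sym_ideal"
  using assms(2) unfolding sym_ideal_def
proof (induction rule: self_module.span_induct_alt)
  case base
  then show ?case by (simp add: free_map_0 self_module.span_zero)
next
  case (step c r y)
  interpret f: Vector_Spaces.linear scaleC scaleC f by (fact assms(1))
  have gen: "free_map f (free_gen a) = free_gen (f a)" for a
    by (simp add: free_gen_def free_map_single)
  have const: "free_map f (free_const k) = free_const k" for k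
    by (simp add: free_const_def free_map_single)
  from step(1) consider
      (add) a b where "r = free_gen (a + b) - free_gen a - free_gen b"
    | (scale) k a where "r = free_gen (k *\<^sub>C a) - free_const k * free_gen a"
    unfolding sym_relators_def by auto
  then have "free_map f r \<in> sym_relators"
  proof cases
    case add
    then have "free_map f r = free_gen (f a + f b) - free_gen (f a) - free_gen (f b)"
      by (simp add: free_map_diff gen f.add)
    then show ?thesis unfolding sym_relators_def by blast
  next
    case scale
    then have "free_map f r = free_gen (k *\<^sub>C f a) - free_const k * free_gen (f a)"
      by (simp add: free_map_diff free_map_mult gen const f.scale)
    then show ?thesis unfolding sym_relators_def by blast
  qed
  then show ?case
    by (simp add: free_map_add free_map_mult step self_module.span_add self_module.span_scale
        self_module.span_base)
qed

text \<open>The algebra homomorphism induced by a linear map (zero if the map is not linear).\<close>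

lift_definition sym_map :: "('a::complex_vector \<Rightarrow> 'b::complex_vector) \<Rightarrow> 'a sym \<Rightarrow> 'b sym"
  is "\<lambda>f x. if clinear f then free_map f x else 0"
proof -
  fix f :: "'a \<Rightarrow> 'b" and x y :: "'a free_calg"
  assume "sym_rel x y"
  then show "sym_rel (if clinear f then free_map f x else 0) (if clinear f then free_map f y else 0)"
    using free_map_ideal[of f "x - y"] by (simp add: sym_rel_def sym_ideal_0 free_map_diff)
qed

text \<open>
  The projective line is \<open>\<complex> \<union> {\<infinity>}\<close>, with \<open>P = \<infinity>\<close> and affine coordinate \<open>u\<close>. A meromorphic form is
  written \<open>a(u) du\<close>; in the coordinate \<open>w = 1/u\<close> at \<open>P\<close> it reads \<open>- a(1/w) / w\<^sup>2 dw\<close>.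
\<close>

definition at_P :: "(complex \<Rightarrow> complex) \<Rightarrow> complex \<Rightarrow> complex" where
  "at_P a w = - a (inverse w) / w\<^sup>2"

definition is_K_form :: "(complex \<Rightarrow> complex) \<Rightarrow> bool" where
  "is_K_form a \<longleftrightarrow> a meromorphic_on UNIV \<and> at_P a meromorphic_on {0} \<and>
     \<not> is_pole (at_P a) 0 \<and> (\<forall>z. residue a z = 0)"

text \<open>The values of a meromorphic function at single points carry no information.\<close>

definition K_rel :: "(complex \<Rightarrow> complex) \<Rightarrow> (complex \<Rightarrow> complex) \<Rightarrow> bool" where
  "K_rel a b \<longleftrightarrow> is_K_form a \<and> is_K_form b \<and> (\<forall>z. \<forall>\<^sub>F u in at z. a u = b u)"

lemma residue_add_mero:
  assumes "f meromorphic_on {z}" "g meromorphic_on {z}"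
  shows "residue (\<lambda>w. f w + g w) z = residue f z + residue g z"
proof -
  obtain F G where FG: "(\<lambda>w. f (z + w)) has_laurent_expansion F"
      "(\<lambda>w. g (z + w)) has_laurent_expansion G"
    using assms by (auto simp: meromorphic_on_def)
  then have "(\<lambda>w. f (z + w) + g (z + w)) has_laurent_expansion F + G"
    by (rule has_laurent_expansion_add)
  from has_laurent_expansion_residue[of "\<lambda>w. f w + g w", OF this]
  show ?thesis
    using FG by (simp add: has_laurent_expansion_residue)
qed

lemma residue_affine_mero:
  assumes "f meromorphic_on {\<alpha> * z + \<beta>}" "\<alpha> \<noteq> 0"
  shows "residue (\<lambda>w. \<alpha> * f (\<alpha> * w + \<beta>)) z = residue f (\<alpha> * z + \<beta>)"
proof -
  define p where "p = \<alpha> * z + \<beta>"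
  obtain F where F: "(\<lambda>w. f (p + w)) has_laurent_expansion F"
    using assms(1) by (auto simp: meromorphic_on_def p_def)
  have "(\<lambda>w. \<alpha> * w) has_laurent_expansion fps_to_fls (fps_const \<alpha> * fps_X)"
    by (intro has_laurent_expansion_fps fps_expansion_intros)
  then have "((\<lambda>w. f (p + w)) \<circ> (\<lambda>w. \<alpha> * w)) has_laurent_expansion
      fls_compose_fps F (fps_const \<alpha> * fps_X)"
    by (rule has_laurent_expansion_compose[OF F]) (use assms(2) in auto)
  then have "(\<lambda>w. \<alpha> * f (p + \<alpha> * w)) has_laurent_expansion
      fls_const \<alpha> * fls_compose_fps F (fps_const \<alpha> * fps_X)"
    by (intro laurent_expansion_intros) (simp add: o_def)
  then have *: "(\<lambda>w. \<alpha> * f (\<alpha> * (z + w) + \<beta>)) has_laurent_expansion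
      fls_const \<alpha> * fls_compose_fps F (fps_const \<alpha> * fps_X)"
    by (simp add: p_def algebra_simps)
  show ?thesis
    using has_laurent_expansion_residue[OF *] has_laurent_expansion_residue[OF F] assms(2)
    by (simp add: fls_nth_fls_compose_fps_linear p_def power_int_minus)
qed

lemma not_pole_imp_tendsto:
  assumes "f meromorphic_on {z}" "\<not> is_pole f z"
  obtains l where "f \<midarrow>z\<rightarrow> l"
  using assms by (auto simp: meromorphic_at_iff not_essential_def)

lemma tendsto_imp_not_pole: "f \<midarrow>z\<rightarrow> l \<Longrightarrow> \<not> is_pole f z" for f :: "complex \<Rightarrow> complex"
  using not_tendsto_and_filterlim_at_infinity[of "at z" f l] by (auto simp: is_pole_def)

lemma is_K_form_0: "is_K_form (\<lambda>_. 0)"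
proof -
  have "at_P (\<lambda>_. 0) = (\<lambda>_. 0)"
    by (simp add: at_P_def fun_eq_iff)
  then show ?thesis
    by (simp add: is_K_form_def residue_const meromorphic_on_const)
qed

lemma is_K_form_add:
  assumes "is_K_form a" "is_K_form b"
  shows "is_K_form (\<lambda>u. a u + b u)"
proof -
  have eq: "at_P (\<lambda>u. a u + b u) = (\<lambda>w. at_P a w + at_P b w)"
    by (auto simp: at_P_def fun_eq_iff diff_divide_distrib add_divide_distrib)
  obtain l m where "at_P a \<midarrow>0\<rightarrow> l" "at_P b \<midarrow>0\<rightarrow> m"
    using assms unfolding is_K_form_def by (metis not_pole_imp_tendsto)
  then have "(\<lambda>w. at_P a w + at_P b w) \<midarrow>0\<rightarrow> l + m"
    by (rule tendsto_add)
  then have "\<not> is_pole (\<lambda>w. at_P a w + at_P b w) 0"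
    by (rule tendsto_imp_not_pole)
  moreover have "residue (\<lambda>u. a u + b u) z = 0" for z
    using assms by (subst residue_add_mero)
      (auto simp: is_K_form_def intro: meromorphic_on_subset)
  ultimately show ?thesis
    using assms by (auto simp: is_K_form_def eq intro: meromorphic_on_add)
qed

lemma is_K_form_pullback:
  assumes "is_K_form a"
  shows "is_K_form (\<lambda>u. \<alpha> * a (\<alpha> * u + \<beta>))"
proof (cases "\<alpha> = 0")
  case True
  then show ?thesis by (simp add: is_K_form_0)
next
  case False
  define g where "g = (\<lambda>w. w / (\<alpha> + \<beta> * w))"
  define b where "b = at_P a"
  have ana: "g analytic_on {0}"
    unfolding g_def using False by (auto intro!: analytic_intros)
  have ana2: "(\<lambda>w. \<alpha> / (\<alpha> + \<beta> * w)\<^sup>2) analytic_on {0}"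
    using False by (auto intro!: analytic_intros)
  have b: "b meromorphic_on {0}" "\<not> is_pole b 0"
    using assms by (auto simp: is_K_form_def b_def)
  have nz: "\<forall>\<^sub>F w in at 0. \<alpha> + \<beta> * w \<noteq> 0"
  proof -
    have "((\<lambda>w. \<alpha> + \<beta> * w) \<longlongrightarrow> \<alpha> + \<beta> * 0) (at 0)"
      by (intro tendsto_intros)
    then show ?thesis
      using tendsto_imp_eventually_ne[of _ "\<alpha> + \<beta> * 0" "at 0" 0] False by simp
  qed
  have ev: "\<forall>\<^sub>F w in at 0. \<alpha> / (\<alpha> + \<beta> * w)\<^sup>2 * b (g w) = at_P (\<lambda>u. \<alpha> * a (\<alpha> * u + \<beta>)) w"
    using nz eventually_neq_at_within[of 0]
  proof eventually_elim
    case (elim w)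
    have "inverse (g w) = \<alpha> * inverse w + \<beta>"
      using elim by (simp add: g_def field_simps)
    then show ?case
      using elim by (simp add: b_def at_P_def) (simp add: g_def field_simps)
  qed
  have mero: "(\<lambda>w. \<alpha> / (\<alpha> + \<beta> * w)\<^sup>2 * b (g w)) meromorphic_on {0}"
    by (intro meromorphic_on_mult meromorphic_on_compose[OF b(1) ana]
        analytic_on_imp_meromorphic_on[OF ana2]) (simp add: g_def)
  obtain l where l: "b \<midarrow>0\<rightarrow> l"
    using b not_pole_imp_tendsto by blast
  have "(g \<longlongrightarrow> 0 / (\<alpha> + \<beta> * 0)) (at 0)"
    unfolding g_def using False by (intro tendsto_intros) auto
  moreover have "\<forall>\<^sub>F w in at 0. g w \<noteq> 0"
    using nz eventually_neq_at_within[of 0] by eventually_elim (simp add: g_def)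
  ultimately have "filterlim g (at 0) (at 0)"
    by (simp add: filterlim_at)
  then have "(\<lambda>w. b (g w)) \<midarrow>0\<rightarrow> l"
    by (rule filterlim_compose[OF l])
  then have "(\<lambda>w. \<alpha> / (\<alpha> + \<beta> * w)\<^sup>2 * b (g w)) \<midarrow>0\<rightarrow> \<alpha> / (\<alpha> + \<beta> * 0)\<^sup>2 * l"
    using False by (intro tendsto_intros) auto
  then have "\<not> is_pole (\<lambda>w. \<alpha> / (\<alpha> + \<beta> * w)\<^sup>2 * b (g w)) 0"
    by (rule tendsto_imp_not_pole)
  then have 1: "\<not> is_pole (at_P (\<lambda>u. \<alpha> * a (\<alpha> * u + \<beta>))) 0"
    using is_pole_cong[OF ev refl] by simp
  have 2: "at_P (\<lambda>u. \<alpha> * a (\<alpha> * u + \<beta>)) meromorphic_on {0}"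
    using mero meromorphic_on_cong[of "{0}" _ _ "{0}"] ev by auto
  have a: "a meromorphic_on UNIV"
    using assms by (simp add: is_K_form_def)
  have 3: "(\<lambda>u. \<alpha> * a (\<alpha> * u + \<beta>)) meromorphic_on UNIV"
    by (intro meromorphic_on_mult meromorphic_on_compose[OF a] analytic_on_imp_meromorphic_on
        analytic_intros) auto
  have 4: "residue (\<lambda>u. \<alpha> * a (\<alpha> * u + \<beta>)) z = 0" for z
    using assms False a by (subst residue_affine_mero)
      (auto simp: is_K_form_def intro: meromorphic_on_subset)
  from 1 2 3 4 show ?thesis
    by (simp add: is_K_form_def)
qed

lemma is_K_form_scale:
  assumes "is_K_form a"
  shows "is_K_form (\<lambda>u. c * a u)"
proof -
  have eq: "at_P (\<lambda>u. c * a u) = (\<lambda>w. c * at_P a w)"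
    by (auto simp: at_P_def fun_eq_iff)
  obtain l where "at_P a \<midarrow>0\<rightarrow> l"
    using assms unfolding is_K_form_def by (metis not_pole_imp_tendsto)
  then have "(\<lambda>w. c * at_P a w) \<midarrow>0\<rightarrow> c * l"
    by (intro tendsto_intros)
  then have "\<not> is_pole (\<lambda>w. c * at_P a w) 0"
    by (rule tendsto_imp_not_pole)
  moreover have "residue (\<lambda>u. c * a u) z = 0" for z
  proof -
    obtain F where F: "(\<lambda>w. a (z + w)) has_laurent_expansion F"
      using assms by (auto simp: is_K_form_def meromorphic_on_def)
    then have "(\<lambda>w. c * a (z + w)) has_laurent_expansion fls_const c * F"
      by (intro laurent_expansion_intros)
    with F show ?thesis
      using assms has_laurent_expansion_residue[OF F]
        has_laurent_expansion_residue[of "\<lambda>u. c * a u" z "fls_const c * F"]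
      by (simp add: is_K_form_def)
  qed
  ultimately show ?thesis
    using assms by (auto simp: is_K_form_def eq intro!: meromorphic_on_mult meromorphic_on_const)
qed

lemma K_relI: "is_K_form a \<Longrightarrow> is_K_form b \<Longrightarrow> (\<And>u. a u = b u) \<Longrightarrow> K_rel a b"
  by (simp add: K_rel_def)

lemma part_equivp_K_rel: "part_equivp K_rel"
proof (rule part_equivpI)
  show "\<exists>a. K_rel a a"
    using is_K_form_0 by (auto simp: K_rel_def)
  show "symp K_rel"
    by (auto simp: symp_def K_rel_def eq_commute)
  show "transp K_rel"
  proof (rule transpI)
    fix a b c
    assume *: "K_rel a b" "K_rel b c"
    have "\<forall>\<^sub>F u in at z. a u = c u" for z
      using * eventually_elim2[of "\<lambda>u. a u = b u" "at z" "\<lambda>u. b u = c u" "\<lambda>u. a u = c u"]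
      by (simp add: K_rel_def)
    with * show "K_rel a c"
      by (simp add: K_rel_def)
  qed
qed

quotient_type kform = "complex \<Rightarrow> complex" / partial: K_rel
  by (rule part_equivp_K_rel)

instantiation kform :: complex_vector
begin

lift_definition zero_kform :: kform is "\<lambda>_. 0"
  by (simp add: K_rel_def is_K_form_0)
lift_definition plus_kform :: "kform \<Rightarrow> kform \<Rightarrow> kform" is "\<lambda>a b u. a u + b u"
proof -
  fix a a' b b'
  assume *: "K_rel a a'" "K_rel b b'"
  have "\<forall>\<^sub>F u in at z. a u + b u = a' u + b' u" for z
    using * eventually_elim2[of "\<lambda>u. a u = a' u" "at z" "\<lambda>u. b u = b' u" "\<lambda>u. a u + b u = a' u + b' u"]
    by (simp add: K_rel_def)
  with * show "K_rel (\<lambda>u. a u + b u) (\<lambda>u. a' u + b' u)"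
    by (simp add: K_rel_def is_K_form_add)
qed
lift_definition scaleC_kform :: "complex \<Rightarrow> kform \<Rightarrow> kform" is "\<lambda>c a u. c * a u"
proof -
  fix c a b
  assume *: "K_rel a b"
  have "\<forall>\<^sub>F u in at z. c * a u = c * b u" for z
    using * eventually_mono[of "\<lambda>u. a u = b u" "at z" "\<lambda>u. c * a u = c * b u"]
    by (simp add: K_rel_def)
  with * show "K_rel (\<lambda>u. c * a u) (\<lambda>u. c * b u)"
    by (simp add: K_rel_def is_K_form_scale)
qed
definition uminus_kform :: "kform \<Rightarrow> kform" where "- a = (-1) *\<^sub>C a" for a :: kform
definition minus_kform :: "kform \<Rightarrow> kform \<Rightarrow> kform" where "a - b = a + - b" for a b :: kform

instance
proof
  fix a b c :: kform and k l :: complex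
  show "a + b + c = a + (b + c)"
    by transfer (rule K_relI,
        auto intro!: is_K_form_add is_K_form_scale is_K_form_0 simp: K_rel_def algebra_simps)
  show "a + b = b + a"
    by transfer (rule K_relI,
        auto intro!: is_K_form_add is_K_form_scale is_K_form_0 simp: K_rel_def algebra_simps)
  show "0 + a = a"
    by transfer (rule K_relI,
        auto intro!: is_K_form_add is_K_form_scale is_K_form_0 simp: K_rel_def algebra_simps)
  show "- a + a = 0"
    unfolding uminus_kform_def by transfer (rule K_relI,
        auto intro!: is_K_form_add is_K_form_scale is_K_form_0 simp: K_rel_def algebra_simps)
  show "a - b = a + - b"
    by (simp add: minus_kform_def)
  show "k *\<^sub>C (a + b) = k *\<^sub>C a + k *\<^sub>C b"
    by transfer (rule K_relI,
        auto intro!: is_K_form_add is_K_form_scale is_K_form_0 simp: K_rel_def algebra_simps)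
  show "(k + l) *\<^sub>C a = k *\<^sub>C a + l *\<^sub>C a"
    by transfer (rule K_relI, simp_all only: K_rel_def is_K_form_scale is_K_form_add distrib_right)
  show "k *\<^sub>C l *\<^sub>C a = (k * l) *\<^sub>C a"
    by transfer (rule K_relI, simp_all only: K_rel_def is_K_form_scale mult.assoc)
  show "1 *\<^sub>C a = a"
    by transfer (simp only: mult_1_left)
qed

end

lift_definition poles :: "kform \<Rightarrow> complex set" is "\<lambda>a. {z. is_pole a z}"
proof -
  fix a b
  assume "K_rel a b"
  then have "is_pole a z \<longleftrightarrow> is_pole b z" for z
    by (intro is_pole_cong) (auto simp: K_rel_def)
  then show "{z. is_pole a z} = {z. is_pole b z}"
    by simp
qed

text \<open>
  The pull-back of \<open>a(u) du\<close> along \<open>u \<mapsto> \<alpha> u + \<beta>\<close>, which for \<open>\<alpha> \<noteq> 0\<close> is an automorphism fixing \<open>P\<close>.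
\<close>

lift_definition pullback :: "complex \<Rightarrow> complex \<Rightarrow> kform \<Rightarrow> kform" is
  "\<lambda>\<alpha> \<beta> a u. \<alpha> * a (\<alpha> * u + \<beta>)"
proof -
  fix \<alpha> \<beta> a b
  assume *: "K_rel a b"
  have "\<forall>\<^sub>F u in at z. \<alpha> * a (\<alpha> * u + \<beta>) = \<alpha> * b (\<alpha> * u + \<beta>)" for z
  proof (cases "\<alpha> = 0")
    case False
    have "((\<lambda>u. \<alpha> * u + \<beta>) \<longlongrightarrow> \<alpha> * z + \<beta>) (at z)"
      by (intro tendsto_intros)
    moreover have "\<forall>\<^sub>F u in at z. \<alpha> * u + \<beta> \<noteq> \<alpha> * z + \<beta>"
      using eventually_neq_at_within[of z] by eventually_elim (simp add: False)
    ultimately have "filterlim (\<lambda>u. \<alpha> * u + \<beta>) (at (\<alpha> * z + \<beta>)) (at z)"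
      by (simp add: filterlim_at)
    moreover have "\<forall>\<^sub>F u in at (\<alpha> * z + \<beta>). a u = b u"
      using * by (simp add: K_rel_def)
    ultimately have "\<forall>\<^sub>F u in at z. a (\<alpha> * u + \<beta>) = b (\<alpha> * u + \<beta>)"
      by (rule eventually_compose_filterlim[rotated])
    then show ?thesis
      by eventually_elim simp
  qed simp
  with * show "K_rel (\<lambda>u. \<alpha> * a (\<alpha> * u + \<beta>)) (\<lambda>u. \<alpha> * b (\<alpha> * u + \<beta>))"
    by (simp add: K_rel_def is_K_form_pullback)
qed

lemma clinear_pullback: "clinear (pullback \<alpha> \<beta>)"
proof unfold_locales
  fix a b :: kform and c :: complex
  show "pullback \<alpha> \<beta> (a + b) = pullback \<alpha> \<beta> a + pullback \<alpha> \<beta> b"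
    by transfer (rule K_relI, simp_all only: K_rel_def is_K_form_add is_K_form_pullback distrib_left)
  show "pullback \<alpha> \<beta> (c *\<^sub>C a) = c *\<^sub>C pullback \<alpha> \<beta> a"
  proof transfer
    fix \<alpha> \<beta> c a
    assume "K_rel a a"
    then have a: "is_K_form a"
      by (simp add: K_rel_def)
    show "K_rel (\<lambda>u. \<alpha> * (c * a (\<alpha> * u + \<beta>))) (\<lambda>u. c * (\<alpha> * a (\<alpha> * u + \<beta>)))"
      using is_K_form_pullback[OF is_K_form_scale[OF a]] is_K_form_scale[OF is_K_form_pullback[OF a]]
      by (rule K_relI) simp
  qed
qed

type_synonym W = "kform sym"

definition K_in :: "complex set \<Rightarrow> kform set" where
  "K_in S = {a. poles a \<subseteq> S}"

definition K_off :: "complex set \<Rightarrow> kform set" where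
  "K_off S = {a. poles a \<inter> S = {}}"

definition W_in :: "complex set \<Rightarrow> W set" where
  "W_in S = Sym (K_in S)"

definition W_off :: "complex set \<Rightarrow> W set" where
  "W_off S = Sym (K_off S)"

definition translate :: "complex \<Rightarrow> complex set \<Rightarrow> complex set" where
  "translate v S = (\<lambda>z. z + v) ` S"

definition rotation :: "complex \<Rightarrow> complex \<Rightarrow> complex \<Rightarrow> complex" where
  "rotation p l z = p + l * (z - p)"

definition trans_op :: "complex \<Rightarrow> W \<Rightarrow> W" where
  "trans_op v = sym_map (pullback 1 (- v))"

text \<open>The rotation \<open>z \<mapsto> p + l (z - p)\<close> has inverse \<open>u \<mapsto> u/l + (p - p/l)\<close>.\<close>

definition rot_op :: "complex \<Rightarrow> complex \<Rightarrow> W \<Rightarrow> W" where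
  "rot_op p l = sym_map (pullback (inverse l) (p - inverse l * p))"

text \<open>
  \<open>Y S x v\<close> is the operator attached to the finite set \<open>S\<close>, the state \<open>x \<in> W_in S\<close> and the
  translation \<open>v\<close>. Only its values on \<open>W_off (translate v S)\<close> are meaningful: nothing is required of
  \<open>Y\<close> outside these domains. In \<open>spanning\<close>, the choice of the point is immaterial in view of the two
  translation axioms.
\<close>

locale vertex_algebra_structure =
  fixes Y :: "complex set \<Rightarrow> W \<Rightarrow> complex \<Rightarrow> W \<Rightarrow> W"
  assumes operator_linear:
      "\<lbrakk>finite S; x \<in> W_in S\<rbrakk> \<Longrightarrow> clinear_on (W_off (translate v S)) (Y S x v)"
    and state_linear:
      "\<lbrakk>finite S; y \<in> W_off (translate v S)\<rbrakk> \<Longrightarrow> clinear_on (W_in S) (\<lambda>x. Y S x v y)"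
    and enlarge:
      "\<lbrakk>finite S'; S \<subseteq> S'; x \<in> W_in S; y \<in> W_off (translate v S')\<rbrakk> \<Longrightarrow> Y S' x v y = Y S x v y"
    and singularities:
      "\<lbrakk>finite S; finite S'; x \<in> W_in S; x' \<in> W_in S' \<inter> W_off (translate v S)\<rbrakk>
       \<Longrightarrow> Y S x v x' \<in> W_in (S' \<union> translate v S)"
    and vacuum:
      "\<lbrakk>finite S; y \<in> W_off (translate v S)\<rbrakk> \<Longrightarrow> Y S 1 v y = y"
    and creation:
      "\<lbrakk>finite S; x \<in> W_in S\<rbrakk> \<Longrightarrow> Y S x 0 1 = x"
    and locality:
      "\<lbrakk>finite S; finite S'; x \<in> W_in S; x' \<in> W_in S'; translate v S \<inter> translate v' S' = {};
        y \<in> W_off (translate v S); Y S x v y \<in> W_off (translate v' S');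
        y \<in> W_off (translate v' S'); Y S' x' v' y \<in> W_off (translate v S)\<rbrakk>
       \<Longrightarrow> Y S x v (Y S' x' v' y) = Y S' x' v' (Y S x v y)"
    and translation:
      "\<lbrakk>finite S; x \<in> W_in S; y \<in> W_off (translate (v + v') S)\<rbrakk>
       \<Longrightarrow> Y S x (v + v') y = trans_op v' (Y S x v (trans_op (- v') y))"
    and translation_covariant:
      "\<lbrakk>finite S; x \<in> W_in S; y \<in> W_off (translate v (translate v' S))\<rbrakk>
       \<Longrightarrow> Y (translate v' S) (trans_op v' x) v y = trans_op v' (Y S x v (trans_op (- v') y))"
    and rotation_covariant:
      "\<lbrakk>finite S; x \<in> W_in S; l \<noteq> 0; y \<in> W_off (translate (l * v) (rotation p l ` S))\<rbrakk>
       \<Longrightarrow> Y (rotation p l ` S) (rot_op p l x) (l * v) y = rot_op p l (Y S x v (rot_op p (inverse l) y))"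
    and spanning:
      "\<exists>p. complex_vector.span
         {foldr (\<lambda>(x, v) y. Y {p} x v y) xvs 1 | xvs.
            distinct (map snd xvs) \<and> (\<forall>(x, v)\<in>set xvs. x \<in> W_in {p})} = UNIV"

end

theory Submission
  imports Defs
begin

text \<open>
  This is Goddard's uniqueness argument. A state \<open>y\<close> regular on both translated sets lies in
  \<open>W_in S\<close> for a finite \<open>S\<close> disjoint from them, since forms have finitely many poles, so
  \<open>y = Y S y 0 1\<close> by creation. Locality moves \<open>Y S y 0\<close> to the left of both sides and reduces the
  identity to the vacuum, where translation and creation turn each side into
  \<open>trans_op v2 (Y S1 x1 (v1 - v2) x2)\<close>.
\<close>

section \<open>Finiteness of the set of poles of a form\<close>

text \<open>Meromorphy of \<open>at_P a\<close> at 0 makes it analytic on a punctured disc of some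
  radius \<open>e\<close>, so \<open>a\<close> has no pole of norm above \<open>1/e\<close>. The
  poles of a meromorphic function are sparse, hence finite in number on that compact disc.\<close>

lemma is_K_form_imp_finite_poles:
  assumes "is_K_form a"
  shows "finite {z. is_pole a z}"
proof -
  have mero: "a meromorphic_on UNIV" and "at_P a meromorphic_on {0}"
    using assms by (auto simp: is_K_form_def)
  then have "\<forall>\<^sub>F w in at 0. at_P a analytic_on {w}"
    using eventually_cosparse_imp_eventually_at meromorphic_on_imp_analytic_cosparse by blast
  then obtain e where e: "e > 0" "\<And>w. w \<noteq> 0 \<Longrightarrow> norm w < e \<Longrightarrow> at_P a analytic_on {w}"
    by (auto simp: eventually_at dist_norm)
  have "norm z \<le> inverse e" if pole: "is_pole a z" for z
  proof (rule ccontr)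
    assume "\<not> norm z \<le> inverse e"
    then have z: "norm z > inverse e" by simp
    then have nz: "z \<noteq> 0"
      using e(1) by auto
    have "inverse (norm z) < e"
      using z e(1) less_imp_inverse_less[of "inverse e" "norm z"] by simp
    then have "at_P a analytic_on {inverse z}"
      using nz by (intro e(2)) (auto simp: norm_inverse)
    then have "(\<lambda>u. at_P a (inverse u)) analytic_on {z}"
      using nz analytic_on_compose[of inverse "{z}" "at_P a"]
        analytic_on_inverse[OF analytic_on_ident, of "{z}"]
      by (simp add: o_def)
    \<comment> \<open>The coordinate change at P is an involution: away from 0 this function is
      \<open>a\<close> itself, so a pole of \<open>a\<close> at \<open>z\<close> contradicts
      analyticity of \<open>at_P a\<close> at \<open>1/z\<close>.\<close>
    then have "(\<lambda>u. - at_P a (inverse u) / u\<^sup>2) analytic_on {z}"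
      using nz by (intro analytic_on_divide analytic_on_neg analytic_on_power analytic_on_ident)
        auto
    then have "\<not> is_pole (\<lambda>u. - at_P a (inverse u) / u\<^sup>2) z"
      by (rule analytic_at_imp_no_pole)
    moreover have ev: "\<forall>\<^sub>F u in at z. - at_P a (inverse u) / u\<^sup>2 = a u"
      using eventually_neq_at_within[of 0]
      by eventually_elim (simp add: at_P_def field_simps)
    ultimately show False
      using pole is_pole_cong[OF ev refl] by blast
  qed
  then have "{z. is_pole a z} = cball 0 (inverse e) \<inter> {z. is_pole a z}"
    by auto
  moreover have "{z. is_pole a z} sparse_in UNIV"
    using meromorphic_on_imp_not_pole_cosparse[OF mero] by (simp add: eventually_cosparse)
  then have "{z. is_pole a z} sparse_in cball 0 (inverse e)"
    by (rule sparse_in_subset) auto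
  then have "finite (cball 0 (inverse e) \<inter> {z. is_pole a z})"
    by (intro sparse_in_compact_finite) auto
  ultimately show ?thesis
    by simp
qed

lemma finite_poles: "finite (poles a)"
  by transfer (simp add: K_rel_def is_K_form_imp_finite_poles)

section \<open>States with poles inside or outside a given set\<close>

lemma Sym_mono:
  assumes "A \<subseteq> B"
  shows "Sym A \<subseteq> Sym B"
proof
  show "x \<in> Sym B" if "x \<in> Sym A" for x
    using that assms by induction (auto intro: Sym.intros)
qed

lemma W_in_mono: "S \<subseteq> T \<Longrightarrow> W_in S \<subseteq> W_in T"
  unfolding W_in_def by (intro Sym_mono) (auto simp: K_in_def)

lemma W_in_subset_W_off: "S \<inter> T = {} \<Longrightarrow> W_in S \<subseteq> W_off T"
  unfolding W_in_def W_off_def by (intro Sym_mono) (auto simp: K_in_def K_off_def)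

lemma W_in_1: "1 \<in> W_in S" and W_off_1: "1 \<in> W_off S"
  by (simp_all add: W_in_def W_off_def Sym.one)

text \<open>A state is a polynomial in finitely many forms, each with finitely many poles;
  \<open>S\<close> collects those poles. This is what makes the creation axiom applicable to an
  arbitrary argument \<open>y\<close>.\<close>

lemma W_off_imp_W_in:
  assumes "y \<in> W_off T"
  obtains S where "finite S" "S \<inter> T = {}" "y \<in> W_in S"
proof -
  have "\<exists>S. finite S \<and> S \<inter> T = {} \<and> y \<in> W_in S"
    using assms unfolding W_off_def
  proof induction
    case one
    then show ?case
      using W_in_1 by blast
  next
    case (incl a)
    then show ?case
      by (intro exI[of _ "poles a"])
        (auto simp: finite_poles K_off_def W_in_def K_in_def intro: Sym.incl)
  next
    case (add x y)
    then obtain S S' where "finite S" "S \<inter> T = {}" "x \<in> W_in S"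
      "finite S'" "S' \<inter> T = {}" "y \<in> W_in S'"
      by blast
    moreover from this have "x \<in> W_in (S \<union> S')" "y \<in> W_in (S \<union> S')"
      using W_in_mono[of _ "S \<union> S'"] by blast+
    ultimately show ?case
      by (intro exI[of _ "S \<union> S'"]) (auto simp: W_in_def intro: Sym.add)
  next
    case (mult x y)
    then obtain S S' where "finite S" "S \<inter> T = {}" "x \<in> W_in S"
      "finite S'" "S' \<inter> T = {}" "y \<in> W_in S'"
      by blast
    moreover from this have "x \<in> W_in (S \<union> S')" "y \<in> W_in (S \<union> S')"
      using W_in_mono[of _ "S \<union> S'"] by blast+
    ultimately show ?case
      by (intro exI[of _ "S \<union> S'"]) (auto simp: W_in_def intro: Sym.mult)
  next
    case (scale x c)
    then show ?case
      by (auto simp: W_in_def intro: Sym.scale)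
  qed
  with that show ?thesis
    by blast
qed

section \<open>Functoriality of the symmetric algebra; translations\<close>

lemma free_map_free_map: "free_map f (free_map g x) = free_map (f \<circ> g) x"
  unfolding free_map_def[of g] free_map_def[of "f \<circ> g"]
  by (simp add: free_map_sum free_map_single multiset.map_comp)

lemma free_map_id: "free_map id x = x"
  using free_calg_eq_sum[of x] by (simp add: free_map_def)

text \<open>Linearity matters here: \<open>sym_map\<close> of a non-linear map is 0 by
  convention.\<close>

lemma sym_map_1:
  assumes "clinear f"
  shows "sym_map f 1 = 1"
  using assms
proof (transfer, goal_cases)
  case (1 f)
  have "free_map f 1 = 1"
    using free_map_single[of f "{#}" 1] by simp
  with 1 show ?case
    by (simp add: sym_rel_def sym_ideal_0)
qed

lemma sym_map_left_inverse:
  assumes "clinear f" "clinear g" "f \<circ> g = id"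
  shows "sym_map f (sym_map g x) = x"
  using assms
  by transfer (simp add: free_map_free_map free_map_id sym_rel_def sym_ideal_0)

lemma pullback_translation_inverse: "pullback 1 v \<circ> pullback 1 (- v) = id"
proof
  show "(pullback 1 v \<circ> pullback 1 (- v)) a = id a" for a
    unfolding o_def id_apply
  proof transfer
    fix v a
    assume "K_rel a a"
    then have a: "is_K_form a"
      by (simp add: K_rel_def)
    then show "K_rel (\<lambda>u. 1 * (1 * a (1 * (1 * u + v) + - v))) a"
      using is_K_form_pullback[OF is_K_form_pullback[OF a, of 1 "- v"], of 1 v]
      by (intro K_relI) auto
  qed
qed

lemma trans_op_1: "trans_op v 1 = 1"
  by (simp add: trans_op_def sym_map_1 clinear_pullback)

lemma trans_op_inverse: "trans_op (- v) (trans_op v x) = x"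
  unfolding trans_op_def
  by (simp add: sym_map_left_inverse clinear_pullback pullback_translation_inverse)

lemma finite_translate: "finite S \<Longrightarrow> finite (translate v S)"
  by (simp add: translate_def)

lemma translate_Un: "translate v (S \<union> T) = translate v S \<union> translate v T"
  by (simp add: translate_def image_Un)

lemma translate_translate: "translate v (translate w S) = translate (w + v) S"
  by (auto simp: translate_def image_image add.assoc)

lemma translate_0: "translate 0 S = S"
  by (simp add: translate_def)

text \<open>Shifting by \<open>w\<close> carries the right-hand intersection to the left-hand one.
  It turns the disjointness hypothesis of the theorem into the domain condition for
  \<open>Y S1 x1 (v1 - v2) x2\<close>.\<close>

lemma translate_disjoint_iff:
  "translate v S \<inter> translate w T = {} \<longleftrightarrow> T \<inter> translate (v - w) S = {}"
proof -
  have "translate w (T \<inter> translate (v - w) S) = translate v S \<inter> translate w T"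
    by (simp add: translate_def image_Int inj_def image_image Int_commute)
  then show ?thesis
    by (metis image_is_empty translate_def)
qed

section \<open>Consequences of the axioms\<close>

context vertex_algebra_structure
begin

text \<open>Write \<open>v\<close> as \<open>0 + v\<close> in the translation axiom: the vacuum is
  translation invariant, and creation evaluates the operator at 0.\<close>

lemma Y_one:
  assumes "finite S" "x \<in> W_in S"
  shows "Y S x v 1 = trans_op v x"
  using translation[OF assms, of 1 0 v] assms
  by (simp add: W_off_1 trans_op_1 creation)

lemma Y_W_in:
  assumes "finite S" "finite S'" "x \<in> W_in S" "y \<in> W_in S'" "S' \<inter> translate v S = {}"
  shows "Y S x v y \<in> W_in (S' \<union> translate v S)"
  using assms W_in_subset_W_off[of S' "translate v S"] by (intro singularities) auto

text \<open>Pairwise disjointness of \<open>T\<close> and the two translated sets yields every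
  domain condition of \<open>locality\<close>, because each operator adds at most its own translated
  set to the poles of \<open>y\<close>.\<close>

lemma Y_commute:
  assumes "finite S" "x \<in> W_in S" "finite S'" "x' \<in> W_in S'" "finite T" "y \<in> W_in T"
    and "translate v S \<inter> translate v' S' = {}" "T \<inter> translate v S = {}" "T \<inter> translate v' S' = {}"
  shows "Y S x v (Y S' x' v' y) = Y S' x' v' (Y S x v y)"
proof (rule locality)
  show "y \<in> W_off (translate v S)" "y \<in> W_off (translate v' S')"
    using assms W_in_subset_W_off by blast+
  show "Y S x v y \<in> W_off (translate v' S')"
    using Y_W_in[of S T x y v] assms
      W_in_subset_W_off[of "T \<union> translate v S" "translate v' S'"] by blast
  show "Y S' x' v' y \<in> W_off (translate v S)"
    using Y_W_in[of S' T x' y v'] assms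
      W_in_subset_W_off[of "T \<union> translate v' S'" "translate v S"] by blast
qed (use assms in auto)

lemma Y_Y_eq_Y:
  assumes fin: "finite S1" "finite S2" and x: "x1 \<in> W_in S1" "x2 \<in> W_in S2"
    and disj: "translate v1 S1 \<inter> translate v2 S2 = {}"
    and S: "finite S" "y \<in> W_in S" "S \<inter> (translate v1 S1 \<union> translate v2 S2) = {}"
  shows "Y S1 x1 v1 (Y S2 x2 v2 y) =
    Y (S2 \<union> translate (v1 - v2) S1) (Y S1 x1 (v1 - v2) x2) v2 y"
proof -
  define w where "w = Y S1 x1 (v1 - v2) x2"
  define R where "R = S2 \<union> translate (v1 - v2) S1"
  have w: "w \<in> W_in R"
    unfolding w_def R_def using fin x disj by (intro Y_W_in) (simp_all add: translate_disjoint_iff)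
  \<comment> \<open>As \<open>(v1 - v2) + v2 = v1\<close>, the operator of \<open>w\<close> at
    \<open>v2\<close> has exactly the singular set of the composition, so \<open>S\<close> avoids it
    too.\<close>
  have R: "finite R" "w \<in> W_in R" "translate v2 R = translate v2 S2 \<union> translate v1 S1"
    using fin w by (auto simp: R_def finite_translate translate_Un translate_translate)
  define z where "z = Y S2 x2 v2 1"
  have z: "z \<in> W_in (translate v2 S2)"
    using Y_W_in[of S2 "{}" x2 1 v2] fin x by (simp add: z_def W_in_1)
  have z_off: "z \<in> W_off (translate v1 S1)"
    using z W_in_subset_W_off disj by blast
  have y: "Y S y 0 1 = y"
    using S by (simp add: creation)
  \<comment> \<open>The vacuum has no poles, hence \<open>T = {}\<close>.\<close>
  have "Y S1 x1 v1 (Y S2 x2 v2 (Y S y 0 1)) = Y S1 x1 v1 (Y S y 0 z)"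
    unfolding z_def using fin x S
    by (subst Y_commute[where T = "{}"]) (auto simp: W_in_1 translate_0)
  also have "\<dots> = Y S y 0 (Y S1 x1 v1 z)"
    using fin x S z disj
    by (intro Y_commute[where T = "translate v2 S2"]) (auto simp: finite_translate translate_0)
  \<comment> \<open>Split \<open>v1\<close> as \<open>(v1 - v2) + v2\<close>. Conjugation by
    \<open>trans_op v2\<close> undoes the shift in \<open>z = trans_op v2 x2\<close>, leaving
    \<open>x2\<close> as the argument at \<open>v1 - v2\<close>.\<close>
  also have "Y S1 x1 v1 z = trans_op v2 w"
    using translation[OF fin(1) x(1), of z "v1 - v2" v2] z_off fin x
    by (simp add: w_def z_def Y_one trans_op_inverse)
  also have "\<dots> = Y R w v2 1"
    using R by (simp add: Y_one)
  \<comment> \<open>Both sides now agree on the vacuum; commuting back restores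
    \<open>y = Y S y 0 1\<close> as the argument.\<close>
  also have "Y S y 0 (Y R w v2 1) = Y R w v2 (Y S y 0 1)"
    using R S by (intro Y_commute[where T = "{}"]) (auto simp: W_in_1 translate_0)
  finally show ?thesis
    by (simp add: y R_def w_def)
qed

end

text \<open>\<open>Y\<close> is constrained only on its domains, so the membership claims accompany
  the identity to ensure that both sides are meaningful.\<close>

theorem theorem10p5:
  fixes Y :: "complex set \<Rightarrow> W \<Rightarrow> complex \<Rightarrow> W \<Rightarrow> W"
    and S1 S2 :: "complex set" and x1 x2 :: W and v1 v2 :: complex
  assumes "vertex_algebra_structure Y"
    and "finite S1" and "finite S2"
    and "x1 \<in> W_in S1" and "x2 \<in> W_in S2"
    and "translate v1 S1 \<inter> translate v2 S2 = {}"
  shows "x2 \<in> W_off (translate (v1 - v2) S1) \<and>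
    Y S1 x1 (v1 - v2) x2 \<in> W_in (S2 \<union> translate (v1 - v2) S1) \<and>
    (\<forall>y \<in> W_off (translate v1 S1 \<union> translate v2 S2).
       Y S2 x2 v2 y \<in> W_off (translate v1 S1) \<and>
       Y S1 x1 v1 (Y S2 x2 v2 y) =
         Y (S2 \<union> translate (v1 - v2) S1) (Y S1 x1 (v1 - v2) x2) v2 y)"
proof -
  interpret vertex_algebra_structure Y
    by (fact assms(1))
  have disj: "S2 \<inter> translate (v1 - v2) S1 = {}"
    using assms(6) by (simp only: translate_disjoint_iff)
  have w: "Y S1 x1 (v1 - v2) x2 \<in> W_in (S2 \<union> translate (v1 - v2) S1)"
    using assms disj by (intro Y_W_in)
  have "Y S2 x2 v2 y \<in> W_off (translate v1 S1) \<and>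
      Y S1 x1 v1 (Y S2 x2 v2 y) =
        Y (S2 \<union> translate (v1 - v2) S1) (Y S1 x1 (v1 - v2) x2) v2 y"
    if y: "y \<in> W_off (translate v1 S1 \<union> translate v2 S2)" for y
  proof -
    obtain S where S: "finite S" "S \<inter> (translate v1 S1 \<union> translate v2 S2) = {}" "y \<in> W_in S"
      using W_off_imp_W_in[OF y] by blast
    then have "Y S2 x2 v2 y \<in> W_in (S \<union> translate v2 S2)"
      using assms by (intro Y_W_in) auto
    moreover have "(S \<union> translate v2 S2) \<inter> translate v1 S1 = {}"
      using S assms(6) by blast
    ultimately have "Y S2 x2 v2 y \<in> W_off (translate v1 S1)"
      using W_in_subset_W_off by blast
    with Y_Y_eq_Y[OF assms(2-6) S(1,3,2)] show ?thesis
      by blast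
  qed
  moreover have "x2 \<in> W_off (translate (v1 - v2) S1)"
    using W_in_subset_W_off[OF disj] assms(5) by blast
  ultimately show ?thesis
    using w by blast
qed

end
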